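(* Let $(S,+)$ be a semigroup and $\circ:S^2\to S$ an arbitrary binary operation. For every finite coloring of $S$ and every $D\in\mathbb{N}$, there is a sequence $(a_i)_{i=0}^{\infty}$ in $S$ such that for every $1\le d\le D$ the set \[\bigcup_{\substack{(m_0,\dots,m_d)\in\mathbb{Z}^{d+1}\\ 0\le m_0<m_1<\dots<m_d}}\{(((x_1\circ x_2)\circ x_3)\circ\cdots)\circ x_d:\ x_i\in \mathrm{FS}(\{a_j\}_{j=m_{i-1}}^{m_i-1})\text{ for each }1\le i\le d\}\] is monochromatic (the color may depend on $d$).
   Context: Semigroups are infinite (discrete) and not assumed commutative. For a sequence $(s_i)$ in $S$ and a nonempty finite set $\alpha=\{\alpha_1<\dots<\alpha_k\}$ of indices, $s_\alpha=s_{\alpha_1}+\dots+s_{\alpha_k}$ (summed in increasing order of index), and for a nonempty index set $I$, $\mathrm{FS}(\{s_i\}_{i\in I})=\{s_\alpha:\alpha\text{ a nonempty finite subset of }I\}$. For $d=1$ the expression $(((x_1\circ x_2)\circ\cdots)\circ x_d)$ means $x_1$. $\mathbb{N}=\{1,2,\dots\}$. *)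

theory Defs
  imports Main
begin

text \<open>The finite sum \<open>s\<^sub>\<alpha>\<close>, taken in increasing order of index. A semigroup has no neutral element,
  so the fold starts from the term of least index; the value is only meaningful for finite,
  nonempty \<open>\<alpha>\<close>.\<close>

definition ordered_sum :: "(nat \<Rightarrow> 'a::semigroup_add) \<Rightarrow> nat set \<Rightarrow> 'a" where
  "ordered_sum s \<alpha> =
     (let xs = map s (sorted_list_of_set \<alpha>) in foldl (+) (hd xs) (tl xs))"

definition FS :: "(nat \<Rightarrow> 'a::semigroup_add) \<Rightarrow> nat set \<Rightarrow> 'a set" where
  "FS s I = {ordered_sum s \<alpha> |\<alpha>. finite \<alpha> \<and> \<alpha> \<noteq> {} \<and> \<alpha> \<subseteq> I}"

text \<open>The left-nested product \<open>(((x\<^sub>1 \<circ> x\<^sub>2) \<circ> x\<^sub>3) \<circ> \<dots>) \<circ> x\<^sub>d\<close> for \<open>d \<ge> 1\<close>; the arguments are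
  indexed from 1, and for \<open>d = 1\<close> the list is empty and the value is \<open>x\<^sub>1\<close>.\<close>

definition left_prod :: "('a \<Rightarrow> 'a \<Rightarrow> 'a) \<Rightarrow> (nat \<Rightarrow> 'a) \<Rightarrow> nat \<Rightarrow> 'a" where
  "left_prod f x d = foldl f (x 1) (map x [2..<Suc d])"

definition monochromatic :: "('a \<Rightarrow> 'c) \<Rightarrow> 'a set \<Rightarrow> bool" where
  "monochromatic c A \<longleftrightarrow> (\<exists>k. \<forall>x\<in>A. c x = k)"

end

theory Submission
  imports Defs
begin

text \<open>Fix an idempotent ultrafilter \<open>q\<close> on \<open>S\<close> (Ellis). Taking limits along \<open>q\<close> in the last factor
  gives colorings \<open>C\<^sub>0 = c\<close> and \<open>C\<^sub>j\<^sub>+\<^sub>1(y) = lim\<^sub>x C\<^sub>j(y \<circ> x)\<close>, and colors \<open>K\<^sub>d = lim\<^sub>x C\<^sub>d\<^sub>-\<^sub>1(x)\<close>. Build the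
  sequence as in the Galvin--Glazer proof of Hindman's theorem, such that each finite sum of terms of
  index at least \<open>m\<close> lies in the \<open>q\<close>-large set of those \<open>x\<close> with \<open>C\<^sub>d\<^sub>-\<^sub>1(x) = K\<^sub>d\<close> and
  \<open>C\<^sub>j(y \<circ> x) = C\<^sub>j\<^sub>+\<^sub>1(y)\<close> for the finitely many products \<open>y\<close> of sums of terms of index less than \<open>m\<close>.
  Then \<open>C\<^sub>d\<^sub>-\<^sub>i\<close> of the product of the first \<open>i\<close> factors is \<open>K\<^sub>d\<close> for each \<open>i\<close>; take \<open>i = d\<close>.\<close>

section \<open>Ultrafilters\<close>

text \<open>Ultrafilters are the points of \<beta>S. A filter \<open>F\<close> stands for the closed
  set of ultrafilters \<open>p \<le> F\<close>, with \<open>bot\<close> for the empty set, so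
  compactness arguments turn into arguments about filters.\<close>

definition ultra :: "'a filter \<Rightarrow> bool" where
  "ultra p \<longleftrightarrow> p \<noteq> bot \<and> (\<forall>P. eventually P p \<or> eventually (\<lambda>x. \<not> P x) p)"

lemma ultra_not_bot: "ultra p \<Longrightarrow> p \<noteq> bot"
  by (simp add: ultra_def)

lemma ultra_not_eventually:
  "ultra p \<Longrightarrow> \<not> eventually P p \<Longrightarrow> eventually (\<lambda>x. \<not> P x) p"
  by (auto simp: ultra_def)

lemma ultra_minimal:
  assumes "ultra p" "F \<le> p" "F \<noteq> bot"
  shows "F = p"
proof (rule antisym)
  show "p \<le> F"
  proof (rule filter_leI, rule ccontr)
    fix P assume P: "eventually P F" "\<not> eventually P p"
    then have "eventually (\<lambda>x. \<not> P x) F"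
      using assms ultra_not_eventually filter_leD by blast
    with P(1) have "eventually (\<lambda>x. False) F"
      by eventually_elim simp
    then show False
      using assms(3) by (simp add: trivial_limit_def)
  qed
qed fact

section \<open>Chains of filters and Zorn's lemma\<close>

lemma eventually_Inf_chain:
  fixes \<C> :: "'a filter set"
  assumes "\<C> \<noteq> {}" "\<And>F G. F \<in> \<C> \<Longrightarrow> G \<in> \<C> \<Longrightarrow> F \<le> G \<or> G \<le> F"
  shows "eventually P (Inf \<C>) \<longleftrightarrow> (\<exists>F\<in>\<C>. eventually P F)"
proof (rule eventually_Inf_base)
  fix F G assume "F \<in> \<C>" "G \<in> \<C>"
  then show "\<exists>x\<in>\<C>. x \<le> inf F G"
    using assms(2) by (metis inf.absorb1 inf.absorb2 order_refl)
qed fact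

lemma minimal_filter_exists:
  fixes \<Phi> :: "'a filter \<Rightarrow> bool"
  assumes "\<Phi> F"
    and "\<And>\<C>. \<C> \<noteq> {} \<Longrightarrow> \<forall>F\<in>\<C>. \<Phi> F \<Longrightarrow> \<forall>F\<in>\<C>. \<forall>G\<in>\<C>. F \<le> G \<or> G \<le> F \<Longrightarrow> \<Phi> (Inf \<C>)"
  obtains M where "\<Phi> M" "\<And>G. \<Phi> G \<Longrightarrow> G \<le> M \<Longrightarrow> G = M"
proof -
  have "\<exists>M\<in>Collect \<Phi>. \<forall>G\<in>Collect \<Phi>. M \<ge> G \<longrightarrow> G = M"
  proof (rule predicate_Zorn)
    show "partial_order_on (Collect \<Phi>) (relation_of (\<ge>) (Collect \<Phi>))"
      by (rule partial_order_on_relation_ofI) auto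
    fix \<C> assume "\<C> \<in> Chains (relation_of (\<ge>) (Collect \<Phi>))"
    then have "\<forall>F\<in>\<C>. \<Phi> F" "\<forall>F\<in>\<C>. \<forall>G\<in>\<C>. F \<le> G \<or> G \<le> F"
      by (auto simp: Chains_def relation_of_def)
    then have "\<Phi> (Inf \<C>)" if "\<C> \<noteq> {}"
      using that assms(2) by blast
    then show "\<exists>u\<in>Collect \<Phi>. \<forall>F\<in>\<C>. F \<ge> u"
      using assms(1) by (cases "\<C> = {}") (blast, blast intro: Inf_lower)
  qed
  then show thesis
    using that by auto
qed

text \<open>Compactness of \<beta>S in filter form: a set is large for the infimum of a chain only
  if it is large for some member, and no member contains the empty set.\<close>

lemma Inf_chain_not_bot:
  fixes \<C> :: "'a filter set"
  assumes "\<C> \<noteq> {}" "\<forall>F\<in>\<C>. \<forall>G\<in>\<C>. F \<le> G \<or> G \<le> F" "\<forall>F\<in>\<C>. F \<noteq> bot"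
  shows "Inf \<C> \<noteq> bot"
  using assms eventually_Inf_chain[of \<C> "\<lambda>_. False"] by (auto simp: trivial_limit_def)

text \<open>A minimal proper filter \<open>p\<close> below \<open>F\<close> is ultra: if the
  complement of a set is not in \<open>p\<close>, adjoining the set keeps \<open>p\<close> proper,
  so by minimality the set was already in \<open>p\<close>.\<close>

lemma ultra_exists:
  assumes "F \<noteq> bot"
  obtains p where "ultra p" "p \<le> F"
proof -
  obtain p where p: "p \<noteq> bot \<and> p \<le> F" "\<And>G. G \<noteq> bot \<and> G \<le> F \<Longrightarrow> G \<le> p \<Longrightarrow> G = p"
  proof (rule minimal_filter_exists[of "\<lambda>G. G \<noteq> bot \<and> G \<le> F"])
    show "F \<noteq> bot \<and> F \<le> F"
      using assms by simp
    fix \<C> :: "'a filter set"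
    assume "\<C> \<noteq> {}" "\<forall>G\<in>\<C>. G \<noteq> bot \<and> G \<le> F" "\<forall>F\<in>\<C>. \<forall>G\<in>\<C>. F \<le> G \<or> G \<le> F"
    then show "Inf \<C> \<noteq> bot \<and> Inf \<C> \<le> F"
      using Inf_chain_not_bot[of \<C>] by (meson Inf_lower2 ex_in_conv)
  qed blast
  have "eventually P p" if "\<not> eventually (\<lambda>x. \<not> P x) p" for P
  proof -
    let ?G = "inf p (principal {x. P x})"
    have "?G \<noteq> bot"
      using that by (auto simp: trivial_limit_def eventually_inf_principal)
    then have "?G = p"
      using p by (meson inf.cobounded1 order_trans)
    moreover have "eventually P ?G"
      by (simp add: eventually_inf_principal)
    ultimately show ?thesis
      by simp
  qed
  then have "ultra p"
    using p by (auto simp: ultra_def)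
  then show thesis
    using p that by blast
qed

lemma ultra_eventually_constant:
  assumes "ultra p" "finite R" "range g \<subseteq> R"
  shows "\<exists>k\<in>R. \<forall>\<^sub>F x in p. g x = k"
proof (rule ccontr)
  assume "\<not> ?thesis"
  then have "\<forall>k\<in>R. \<forall>\<^sub>F x in p. g x \<noteq> k"
    using assms(1) ultra_not_eventually by blast
  then have "\<forall>\<^sub>F x in p. \<forall>k\<in>R. g x \<noteq> k"
    using assms(2) by (simp add: eventually_ball_finite)
  then have "\<forall>\<^sub>F x in p. False"
    using assms(3) by (auto elim!: eventually_mono)
  then show False
    using ultra_not_bot[OF assms(1)] by (simp add: trivial_limit_def)
qed

section \<open>Idempotent ultrafilters\<close>

text \<open>On ultrafilters this is the addition of \<beta>S that is continuous in the left
  argument. For ultra \<open>q\<close>, \<open>filter_add F q\<close> represents the closed set of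
  all \<open>p + q\<close> with ultra \<open>p \<le> F\<close>.\<close>

definition filter_add :: "'a::semigroup_add filter \<Rightarrow> 'a filter \<Rightarrow> 'a filter" where
  "filter_add F G = Abs_filter (\<lambda>P. \<forall>\<^sub>F x in F. \<forall>\<^sub>F y in G. P (x + y))"

lemma eventually_filter_add:
  "eventually P (filter_add F G) \<longleftrightarrow> (\<forall>\<^sub>F x in F. \<forall>\<^sub>F y in G. P (x + y))"
  unfolding filter_add_def
proof (rule eventually_Abs_filter, unfold_locales)
  fix P Q
  assume "\<forall>\<^sub>F x in F. \<forall>\<^sub>F y in G. P (x + y)" "\<forall>\<^sub>F x in F. \<forall>\<^sub>F y in G. Q (x + y)"
  then show "\<forall>\<^sub>F x in F. \<forall>\<^sub>F y in G. P (x + y) \<and> Q (x + y)"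
    by eventually_elim (rule eventually_conj)
next
  fix P Q
  assume "\<forall>x. P x \<longrightarrow> Q x" "\<forall>\<^sub>F x in F. \<forall>\<^sub>F y in G. P (x + y)"
  then show "\<forall>\<^sub>F x in F. \<forall>\<^sub>F y in G. Q (x + y)"
    by (auto elim!: eventually_mono)
qed simp

lemma filter_add_assoc:
  "filter_add (filter_add F G) H = filter_add F (filter_add G H)"
  by (simp add: filter_eq_iff eventually_filter_add add.assoc)

lemma filter_add_mono:
  assumes "F \<le> F'" "G \<le> G'"
  shows "filter_add F G \<le> filter_add F' G'"
proof (rule filter_leI)
  fix P assume "eventually P (filter_add F' G')"
  then have "\<forall>\<^sub>F x in F. \<forall>\<^sub>F y in G'. P (x + y)"
    using assms(1) by (auto simp: eventually_filter_add dest: filter_leD)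
  then show "eventually P (filter_add F G)"
    unfolding eventually_filter_add
    by (rule eventually_mono) (rule filter_leD[OF assms(2)])
qed

lemma filter_add_not_bot:
  "F \<noteq> bot \<Longrightarrow> G \<noteq> bot \<Longrightarrow> filter_add F G \<noteq> bot"
  by (auto simp: trivial_limit_def eventually_filter_add)

text \<open>The upper adjoint of right addition of \<open>q\<close>. In terms of \<open>\<beta>S\<close>, it represents the closed set of
  those ultrafilters \<open>p\<close> for which \<open>p + q\<close> refines \<open>r\<close>.\<close>

definition filter_diff :: "'a::semigroup_add filter \<Rightarrow> 'a filter \<Rightarrow> 'a filter" where
  "filter_diff r q =
     Abs_filter (\<lambda>P. \<exists>A. eventually A r \<and> (\<forall>x. (\<forall>\<^sub>F y in q. A (x + y)) \<longrightarrow> P x))"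

lemma eventually_filter_diff:
  "eventually P (filter_diff r q) \<longleftrightarrow>
     (\<exists>A. eventually A r \<and> (\<forall>x. (\<forall>\<^sub>F y in q. A (x + y)) \<longrightarrow> P x))"
  unfolding filter_diff_def
proof (rule eventually_Abs_filter, unfold_locales)
  show "\<exists>A. eventually A r \<and> (\<forall>x. (\<forall>\<^sub>F y in q. A (x + y)) \<longrightarrow> True)"
    by (intro exI[of _ "\<lambda>_. True"]) simp
next
  fix P Q
  assume "\<exists>A. eventually A r \<and> (\<forall>x. (\<forall>\<^sub>F y in q. A (x + y)) \<longrightarrow> P x)"
    "\<exists>A. eventually A r \<and> (\<forall>x. (\<forall>\<^sub>F y in q. A (x + y)) \<longrightarrow> Q x)"
  then obtain A B where
    "eventually A r" "\<And>x. \<forall>\<^sub>F y in q. A (x + y) \<Longrightarrow> P x"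
    "eventually B r" "\<And>x. \<forall>\<^sub>F y in q. B (x + y) \<Longrightarrow> Q x"
    by blast
  then show "\<exists>A. eventually A r \<and> (\<forall>x. (\<forall>\<^sub>F y in q. A (x + y)) \<longrightarrow> P x \<and> Q x)"
    by (intro exI[of _ "\<lambda>x. A x \<and> B x"]) (simp add: eventually_conj_iff)
qed blast

lemma filter_add_le_iff: "filter_add p q \<le> r \<longleftrightarrow> p \<le> filter_diff r q"
proof
  assume *: "filter_add p q \<le> r"
  show "p \<le> filter_diff r q"
  proof (rule filter_leI)
    fix P assume "eventually P (filter_diff r q)"
    then obtain A where A: "eventually A r" "\<And>x. \<forall>\<^sub>F y in q. A (x + y) \<Longrightarrow> P x"
      unfolding eventually_filter_diff by blast
    have "eventually A (filter_add p q)"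
      using * A(1) by (rule filter_leD)
    then show "eventually P p"
      unfolding eventually_filter_add by (rule eventually_mono) (rule A(2))
  qed
next
  assume *: "p \<le> filter_diff r q"
  show "filter_add p q \<le> r"
  proof (rule filter_leI)
    fix A assume "eventually A r"
    then have "\<forall>\<^sub>F x in filter_diff r q. \<forall>\<^sub>F y in q. A (x + y)"
      unfolding eventually_filter_diff by blast
    then show "eventually A (filter_add p q)"
      unfolding eventually_filter_add by (rule filter_leD[OF *])
  qed
qed

text \<open>This serves to write an ultrafilter \<open>r\<close> below \<open>filter_add F q\<close>
  as \<open>p + q\<close> with \<open>p \<le> F\<close>. If no such \<open>p\<close> existed, some
  \<open>A\<close> in \<open>r\<close> would fail for \<open>q\<close>-most translates at
  \<open>F\<close>-most points, because \<open>q\<close> is ultra; then the complement of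
  \<open>A\<close> would be in \<open>r\<close> too.\<close>

lemma inf_filter_diff_not_bot:
  assumes "ultra q" "r \<noteq> bot" "r \<le> filter_add F q"
  shows "inf F (filter_diff r q) \<noteq> bot"
proof
  assume "inf F (filter_diff r q) = bot"
  then obtain P Q where PQ: "eventually P F" "eventually Q (filter_diff r q)" "\<And>x. P x \<Longrightarrow> \<not> Q x"
    unfolding trivial_limit_def eventually_inf by blast
  then obtain A where A: "eventually A r" "\<And>x. \<forall>\<^sub>F y in q. A (x + y) \<Longrightarrow> Q x"
    unfolding eventually_filter_diff by blast
  have "\<forall>\<^sub>F x in filter_add F q. \<not> A x"
    unfolding eventually_filter_add
    using PQ(1) by (rule eventually_mono) (use PQ(3) A(2) assms(1) ultra_not_eventually in blast)
  then have "\<forall>\<^sub>F x in r. \<not> A x"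
    using assms(3) by (rule filter_leD[rotated])
  with A(1) have "\<forall>\<^sub>F x in r. False"
    by eventually_elim simp
  then show False
    using assms(2) by (simp add: trivial_limit_def)
qed

text \<open>These filters correspond to certain closed subsemigroups of \<open>\<beta>S\<close>. The argument is that of the
  Ellis--Numakura lemma, applied to a minimal such filter.\<close>

definition additive_filter :: "'a::semigroup_add filter \<Rightarrow> bool" where
  "additive_filter F \<longleftrightarrow> F \<noteq> bot \<and> (\<forall>q. ultra q \<longrightarrow> q \<le> F \<longrightarrow> filter_add F q \<le> F)"

lemma additive_filter_Inf_chain:
  fixes \<C> :: "'a::semigroup_add filter set"
  assumes ne: "\<C> \<noteq> {}" and add: "\<forall>F\<in>\<C>. additive_filter F"
    and chain: "\<forall>F\<in>\<C>. \<forall>G\<in>\<C>. F \<le> G \<or> G \<le> F"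
  shows "additive_filter (Inf \<C>)"
  unfolding additive_filter_def
proof (intro conjI allI impI)
  show "Inf \<C> \<noteq> bot"
    using assms by (intro Inf_chain_not_bot) (auto simp: additive_filter_def)
  fix q assume q: "ultra q" "q \<le> Inf \<C>"
  show "filter_add (Inf \<C>) q \<le> Inf \<C>"
  proof (rule Inf_greatest)
    fix F assume F: "F \<in> \<C>"
    then have "filter_add F q \<le> F"
      using add q by (meson Inf_lower additive_filter_def order_trans)
    moreover have "filter_add (Inf \<C>) q \<le> filter_add F q"
      using F by (intro filter_add_mono Inf_lower) auto
    ultimately show "filter_add (Inf \<C>) q \<le> F"
      by simp
  qed
qed

text \<open>Writing \<open>r = p + q\<close> with \<open>p \<le> F\<close>, associativity gives
  \<open>(F + q) + r = ((F + q) + p) + q \<le> F + q\<close>.\<close>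

lemma additive_filter_translate:
  assumes F: "additive_filter F" and q: "ultra q" "q \<le> F"
  shows "additive_filter (filter_add F q)"
  unfolding additive_filter_def
proof (intro conjI allI impI)
  show "filter_add F q \<noteq> bot"
    using F ultra_not_bot[OF q(1)] by (auto simp: additive_filter_def dest: filter_add_not_bot)
  fix r assume r: "ultra r" "r \<le> filter_add F q"
  then obtain p where p: "ultra p" "p \<le> F" "p \<le> filter_diff r q"
    using ultra_exists[OF inf_filter_diff_not_bot[OF q(1) ultra_not_bot[OF r(1)] r(2)]] by auto
  then have "filter_add p q = r"
    using q r by (intro ultra_minimal filter_add_not_bot) (simp_all add: filter_add_le_iff ultra_not_bot)
  moreover have "filter_add (filter_add F q) p \<le> F"
    using F p q by (meson additive_filter_def filter_add_mono order_refl order_trans)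
  ultimately show "filter_add (filter_add F q) r \<le> filter_add F q"
    by (metis filter_add_assoc filter_add_mono order_refl)
qed

text \<open>The filter represents the \<open>p \<le> F\<close> with \<open>p + q = q\<close>, which
  exist because \<open>q\<close> lies below \<open>F + q\<close>. If \<open>r + q = q\<close>, then
  \<open>(G + r) + q = G + q \<le> q\<close>, where \<open>G\<close> is this filter.\<close>

lemma additive_filter_stabilizer:
  assumes F: "additive_filter F" and q: "ultra q" "q \<le> filter_add F q"
  shows "additive_filter (inf F (filter_diff q q))"
  unfolding additive_filter_def
proof (intro conjI allI impI)
  let ?G = "inf F (filter_diff q q)"
  show "?G \<noteq> bot"
    using q ultra_not_bot by (intro inf_filter_diff_not_bot) auto
  fix r assume r: "ultra r" "r \<le> ?G"
  then have rq: "filter_add r q = q"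
    using q by (intro ultra_minimal filter_add_not_bot) (simp_all add: filter_add_le_iff ultra_not_bot)
  have "filter_add ?G r \<le> F"
    using F r by (metis additive_filter_def filter_add_mono inf.boundedE inf.cobounded1 order_refl order_trans)
  moreover have "filter_add (filter_add ?G r) q \<le> q"
    unfolding filter_add_assoc rq by (simp add: filter_add_le_iff)
  ultimately show "filter_add ?G r \<le> ?G"
    by (simp add: filter_add_le_iff)
qed

theorem idempotent_ultrafilter_exists:
  obtains q :: "'a::semigroup_add filter" where "ultra q" "filter_add q q = q"
proof -
  have "additive_filter (top :: 'a filter)"
    by (simp add: additive_filter_def trivial_limit_def)
  then obtain F :: "'a filter" where F: "additive_filter F"
      "\<And>G. additive_filter G \<Longrightarrow> G \<le> F \<Longrightarrow> G = F"
    by (rule minimal_filter_exists) (use additive_filter_Inf_chain in blast)+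
  obtain q where q: "ultra q" "q \<le> F"
    using F(1) ultra_exists by (auto simp: additive_filter_def)
  \<comment> \<open>Minimality of \<open>F\<close> is used twice: here for the translate, then for
    the stabilizer of \<open>q\<close>. The latter equals \<open>F\<close>, hence has
    \<open>q\<close> itself below it.\<close>
  then have "filter_add F q = F"
    using F additive_filter_translate additive_filter_def by blast
  with q have "additive_filter (inf F (filter_diff q q))"
    using F(1) by (intro additive_filter_stabilizer) auto
  then have "inf F (filter_diff q q) = F"
    using F(2) by simp
  then have "filter_add q q \<le> q"
    using q(2) by (metis filter_add_le_iff inf.boundedE)
  then show thesis
    using q(1) that ultra_minimal filter_add_not_bot ultra_not_bot by metis
qed

section \<open>Finite sums and products\<close>

lemma foldl_add_assoc:
  fixes x y :: "'a::semigroup_add"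
  shows "foldl (+) (x + y) zs = x + foldl (+) y zs"
  by (induction zs arbitrary: y) (simp_all add: add.assoc)

lemma ordered_sum_cong:
  assumes "\<And>i. i \<in> \<alpha> \<Longrightarrow> s i = t i"
  shows "ordered_sum s \<alpha> = ordered_sum t \<alpha>"
proof -
  have "map s (sorted_list_of_set \<alpha>) = map t (sorted_list_of_set \<alpha>)"
    using assms by (cases "finite \<alpha>") auto
  then show ?thesis
    by (simp only: ordered_sum_def)
qed

lemma FS_cong:
  assumes "\<And>i. i \<in> I \<Longrightarrow> s i = t i"
  shows "FS s I = FS t I"
proof -
  have "ordered_sum s \<alpha> = ordered_sum t \<alpha>" if "\<alpha> \<subseteq> I" for \<alpha>
    using assms that by (intro ordered_sum_cong) auto
  then show ?thesis
    unfolding FS_def by (metis (no_types, lifting))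
qed

lemma FS_mono: "I \<subseteq> J \<Longrightarrow> FS s I \<subseteq> FS s J"
  unfolding FS_def by blast

lemma finite_FS: "finite I \<Longrightarrow> finite (FS s I)"
  by (rule finite_subset[of _ "ordered_sum s ` Pow I"]) (auto simp: FS_def)

lemma left_prod_Suc_0 [simp]: "left_prod f x (Suc 0) = x (Suc 0)"
  by (simp add: left_prod_def)

lemma left_prod_Suc: "d \<ge> 1 \<Longrightarrow> left_prod f x (Suc d) = f (left_prod f x d) (x (Suc d))"
  by (simp add: left_prod_def upt_Suc_append)

text \<open>Bounding the list length makes finiteness immediate. The empty list contributes only the
  unspecified value \<open>hd []\<close>, which adds a single element.\<close>

definition products :: "('a \<Rightarrow> 'a \<Rightarrow> 'a) \<Rightarrow> 'a set \<Rightarrow> nat \<Rightarrow> 'a set" where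
  "products f W n = (\<lambda>xs. foldl f (hd xs) (tl xs)) ` {xs. set xs \<subseteq> W \<and> length xs \<le> n}"

lemma finite_products: "finite W \<Longrightarrow> finite (products f W n)"
  by (simp add: products_def finite_lists_length_le)

lemma left_prod_in_products:
  assumes "1 \<le> i" "i \<le> n" "\<And>j. j \<in> {1..i} \<Longrightarrow> x j \<in> W"
  shows "left_prod f x i \<in> products f W n"
  unfolding products_def
proof (rule image_eqI)
  have "[1..<Suc i] = 1 # [2..<Suc i]"
    using assms(1) by (simp add: upt_conv_Cons numeral_2_eq_2)
  then show "left_prod f x i = foldl f (hd (map x [1..<Suc i])) (tl (map x [1..<Suc i]))"
    by (simp add: left_prod_def)
  show "map x [1..<Suc i] \<in> {xs. set xs \<subseteq> W \<and> length xs \<le> n}"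
    using assms by auto
qed

section \<open>The Galvin--Glazer construction\<close>

lemma FS_subset_decreasing:
  fixes a :: "nat \<Rightarrow> 'a::semigroup_add"
  assumes a: "\<And>n. a n \<in> B n"
    and B: "\<And>n. B (Suc n) \<subseteq> B n" "\<And>n y. y \<in> B (Suc n) \<Longrightarrow> a n + y \<in> B n"
  shows "FS a {m..} \<subseteq> B m"
proof -
  have anti: "B n \<subseteq> B m" if "m \<le> n" for m n
    using that B(1) by (rule lift_Suc_antimono_le[rotated])
  \<comment> \<open>Peel off the term of least index \<open>x\<close>: the rest of the sum starts
    after \<open>x\<close>, so it lies in \<open>B (Suc x)\<close>, and adding \<open>a x\<close> on
    the left leads into \<open>B x\<close>.\<close>
  have *: "foldl (+) (a x) (map a xs) \<in> B m" if "sorted_wrt (<) (x # xs)" "m \<le> x" for x xs m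
    using that
  proof (induction xs arbitrary: x m)
    case Nil
    then show ?case
      using a anti by auto
  next
    case (Cons y ys)
    then have "foldl (+) (a y) (map a ys) \<in> B (Suc x)"
      by (intro Cons.IH) auto
    then show ?case
      using B(2) anti[OF Cons.prems(2)] by (auto simp: foldl_add_assoc)
  qed
  show ?thesis
  proof
    fix z assume "z \<in> FS a {m..}"
    then obtain \<alpha> where \<alpha>: "z = ordered_sum a \<alpha>" "finite \<alpha>" "\<alpha> \<noteq> {}" "\<alpha> \<subseteq> {m..}"
      by (auto simp: FS_def)
    then obtain x xs where xs: "sorted_list_of_set \<alpha> = x # xs"
      by (metis list.exhaust sorted_list_of_set_eq_Nil_iff)
    then have "x \<in> \<alpha>"
      using \<alpha>(2) by (metis list.set_intros(1) set_sorted_list_of_set)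
    moreover have "sorted_wrt (<) (x # xs)"
      by (metis xs strict_sorted_list_of_set)
    ultimately show "z \<in> B m"
      using * \<alpha> xs by (auto simp: ordered_sum_def)
  qed
qed

lemma idempotent_filter_FS_sequence:
  fixes q :: "'a::semigroup_add filter"
  assumes q: "q \<noteq> bot" "filter_add q q = q"
    and A: "\<And>h. \<forall>\<^sub>F x in q. x \<in> A h"
  obtains a where "\<And>m. FS a {m..} \<subseteq> A (map a [0..<m])"
proof -
  \<comment> \<open>A state pairs the list of terms chosen so far with a \<open>q\<close>-large set
    to which all later finite sums are confined. The clause for \<open>n = 0\<close> makes the list
    start empty.\<close>
  define P where "P n s \<longleftrightarrow> (\<forall>\<^sub>F x in q. x \<in> snd s) \<and> snd s \<subseteq> A (fst s) \<and> (n = 0 \<longrightarrow> fst s = [])"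
    for n :: nat and s :: "'a list \<times> 'a set"
  define Q where "Q s t x \<longleftrightarrow>
      x \<in> snd s \<and> fst t = fst s @ [x] \<and> snd t \<subseteq> {y \<in> snd s. x + y \<in> snd s}"
    for s t :: "'a list \<times> 'a set" and x
  have "\<exists>s. \<forall>n. P n (s n) \<and> (\<exists>x. Q (s n) (s (Suc n)) x)"
  proof (rule dependent_nat_choice)
    show "\<exists>s. P 0 s"
      using A by (intro exI[of _ "([], A [])"]) (simp add: P_def)
  next
    fix s n assume s: "P n s"
    let ?B = "snd s"
    have large: "\<forall>\<^sub>F x in q. x \<in> ?B"
      using s by (simp add: P_def)
    then have "\<forall>\<^sub>F x in filter_add q q. x \<in> ?B"
      by (simp only: q(2))
    then have "\<forall>\<^sub>F x in q. \<forall>\<^sub>F y in q. x + y \<in> ?B"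
      by (simp only: eventually_filter_add)
    with large have "\<forall>\<^sub>F x in q. x \<in> ?B \<and> (\<forall>\<^sub>F y in q. x + y \<in> ?B)"
      by (simp add: eventually_conj_iff)
    then obtain x where x: "x \<in> ?B" "\<forall>\<^sub>F y in q. x + y \<in> ?B"
      using q(1) eventually_happens' by blast
    let ?h = "fst s @ [x]"
    \<comment> \<open>The translate condition keeps sums starting with \<open>x\<close> inside
      \<open>?B\<close>; the factor \<open>A ?h\<close> imposes the requirement that depends on the
      extended history.\<close>
    let ?t = "(?h, {y \<in> ?B. x + y \<in> ?B} \<inter> A ?h)"
    have "P (Suc n) ?t" "Q s ?t x"
      using x large A[of ?h] by (auto simp: P_def Q_def eventually_conj_iff)
    then show "\<exists>t. P (Suc n) t \<and> (\<exists>x. Q s t x)"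
      by blast
  qed
  then obtain s a where s: "\<And>n. P n (s n)" and a: "\<And>n. Q (s n) (s (Suc n)) (a n)"
    by metis
  have fst_0: "fst (s 0) = []" and subset: "snd (s n) \<subseteq> A (fst (s n))" for n
    using s[of 0] s[of n] by (simp_all add: P_def)
  have fst_Suc: "fst (s (Suc n)) = fst (s n) @ [a n]" for n
    using a[of n] by (simp add: Q_def)
  have fst_eq: "fst (s n) = map a [0..<n]" for n
    by (induction n) (simp_all add: fst_0 fst_Suc)
  have "FS a {m..} \<subseteq> snd (s m)" for m
  proof (rule FS_subset_decreasing)
    fix n
    show "a n \<in> snd (s n)" "snd (s (Suc n)) \<subseteq> snd (s n)"
      using a[of n] by (auto simp: Q_def)
    show "a n + y \<in> snd (s n)" if "y \<in> snd (s (Suc n))" for y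
      using a[of n] that by (auto simp: Q_def)
  qed
  then show thesis
    using subset fst_eq that by (metis subset_trans)
qed

section \<open>Iterated limit colorings\<close>

text \<open>Each limit exists because the colors stay in the finite set \<open>range c\<close>,
  which the recursion carries along as an invariant.\<close>

lemma iterated_limit_colorings:
  fixes c :: "'a \<Rightarrow> 'c"
  assumes "ultra q" "finite (range c)"
  obtains C where "C 0 = c" "\<And>j. range (C j) \<subseteq> range c"
    "\<And>j y. \<forall>\<^sub>F x in q. C j (circ y x) = C (Suc j) y"
proof -
  have "\<exists>C. \<forall>j. (range (C j) \<subseteq> range c \<and> (j = 0 \<longrightarrow> C j = c)) \<and>
      (\<forall>y. \<forall>\<^sub>F x in q. C j (circ y x) = C (Suc j) y)"
  proof (rule dependent_nat_choice)
    fix g :: "'a \<Rightarrow> 'c" and n :: nat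
    assume g: "range g \<subseteq> range c \<and> (n = 0 \<longrightarrow> g = c)"
    have "\<exists>k\<in>range c. \<forall>\<^sub>F x in q. g (circ y x) = k" for y
      using assms g by (intro ultra_eventually_constant) auto
    then obtain g' where "\<And>y. g' y \<in> range c" "\<And>y. \<forall>\<^sub>F x in q. g (circ y x) = g' y"
      by metis
    then show "\<exists>g'. (range g' \<subseteq> range c \<and> (Suc n = 0 \<longrightarrow> g' = c)) \<and>
        (\<forall>y. \<forall>\<^sub>F x in q. g (circ y x) = g' y)"
      by blast
  qed blast
  then show thesis
    using that by blast
qed

section \<open>Colors of left-nested products of sums from successive blocks\<close>

theorem theorem1p9:
  fixes circ :: "'a::semigroup_add \<Rightarrow> 'a \<Rightarrow> 'a"
    and c :: "'a \<Rightarrow> 'c"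
    and D :: nat
  assumes "infinite (UNIV :: 'a set)"
    and "finite (range c)"
    and "D \<ge> 1"
  shows "\<exists>a :: nat \<Rightarrow> 'a. \<forall>d\<in>{1..D}.
    monochromatic c
      (\<Union>m \<in> {m :: nat \<Rightarrow> nat. strict_mono_on {0..d} m}.
        {left_prod circ x d |x. \<forall>i\<in>{1..d}. x i \<in> FS a {m (i - 1)..<m i}})"
proof -
  obtain q :: "'a filter" where q: "ultra q" "filter_add q q = q"
    by (rule idempotent_ultrafilter_exists)
  obtain C where C: "C 0 = c" "\<And>j. range (C j) \<subseteq> range c"
    "\<And>j y. \<forall>\<^sub>F x in q. C j (circ y x) = C (Suc j) y"
    using iterated_limit_colorings[OF q(1) assms(2)] by blast
  have "\<exists>k. \<forall>\<^sub>F x in q. C (d - 1) x = k" for d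
    using ultra_eventually_constant[OF q(1) assms(2) C(2)] by blast
  then obtain K where K: "\<And>d. \<forall>\<^sub>F x in q. C (d - 1) x = K d"
    by metis
  \<comment> \<open>A history \<open>h\<close> lists the terms of index below
    \<open>length h\<close>, the only indices at which \<open>nth h\<close> is meaningful.
    \<open>Y h\<close> is finite, so \<open>A h\<close> is a finite intersection of
    \<open>q\<close>-large sets.\<close>
  define Y where "Y h = products circ (FS (nth h) {..<length h}) D" for h
  define A where "A h = {x. (\<forall>d\<in>{1..D}. C (d - 1) x = K d) \<and>
      (\<forall>y\<in>Y h. \<forall>j\<in>{..<D}. C j (circ y x) = C (Suc j) y)}" for h
  have "\<forall>\<^sub>F x in q. x \<in> A h" for h
    using K C(3) by (auto simp: A_def Y_def finite_products finite_FS
        intro!: eventually_conj eventually_ball_finite)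
  then obtain a where a: "\<And>m. FS a {m..} \<subseteq> A (map a [0..<m])"
    using idempotent_filter_FS_sequence[OF ultra_not_bot[OF q(1)] q(2)] by blast
  have Y: "Y (map a [0..<m]) = products circ (FS a {..<m}) D" for m
    using FS_cong[of "{..<m}" "nth (map a [0..<m])" a] by (simp add: Y_def)
  have "c (left_prod circ x d) = K d"
    if d: "d \<in> {1..D}" and m: "strict_mono_on {0..d} m"
      and x: "\<forall>i\<in>{1..d}. x i \<in> FS a {m (i - 1)..<m i}" for d m x
  proof -
    have xA: "x i \<in> A (map a [0..<m (i - 1)])" if "i \<in> {1..d}" for i
    proof -
      have "FS a {m (i - 1)..<m i} \<subseteq> FS a {m (i - 1)..}"
        by (rule FS_mono) auto
      then show ?thesis
        using that x a by blast
    qed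
    \<comment> \<open>The remaining \<open>d - i\<close> factors are accounted for by iterated
      limits; each new factor replaces one limit by an actual value.\<close>
    have "C (d - i) (left_prod circ x i) = K d" if "1 \<le> i" "i \<le> d" for i
      using that
    proof (induction i rule: dec_induct)
      case base
      then show ?case
        using xA[of 1] d by (simp add: A_def)
    next
      case (step i)
      have "x j \<in> FS a {..<m i}" if "j \<in> {1..i}" for j
      proof -
        have "m j \<le> m i"
          using that step.prems by (intro strict_mono_on_leD[OF m]) auto
        then have "FS a {m (j - 1)..<m j} \<subseteq> FS a {..<m i}"
          by (intro FS_mono) auto
        moreover have "x j \<in> FS a {m (j - 1)..<m j}"
          using x that step.prems by auto
        ultimately show ?thesis
          by blast
      qed
      \<comment> \<open>The first \<open>i\<close> factors use only indices below
        \<open>m i\<close>, exactly the history that the factor \<open>x (Suc i)\<close> was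
        required to respect.\<close>
      then have "left_prod circ x i \<in> Y (map a [0..<m i])"
        unfolding Y using step d by (intro left_prod_in_products) auto
      then have "C (d - Suc i) (left_prod circ x (Suc i)) = C (Suc (d - Suc i)) (left_prod circ x i)"
        using xA[of "Suc i"] step d by (simp add: A_def left_prod_Suc)
      then show ?case
        using step by (simp add: Suc_diff_Suc)
    qed
    from this[of d] show ?thesis
      using d C(1) by simp
  qed
  then show ?thesis
    unfolding monochromatic_def by (intro exI[of _ a] ballI, rule_tac exI) blast
qed

end
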